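(* Let $(g(n))_{n\ge1}$ be any sequence of complex numbers. Then there exist sequences $(P(n))_{n\ge0}$ with $P(0)=1$, $(b_n)_{n\ge1}$, and numbers $F_k(n)$ ($n\ge1$, $1\le k\le n$) such that for all $n\ge1$: $$\sum_{k=1}^nkF_k(n)=nP(n),\qquad iF_i(n)=\sum_{j=1}^n a'_i(j)P(n-j)\ (1\le i\le n),\ \text{ where } a'_i(j)=\begin{cases}ib_i,& j=ri \text{ for some integer } r\ge 1,\\0,&\text{otherwise},\end{cases}$$ and $$nP(n)=\sum_{k=1}^ng(k)P(n-k).$$ Moreover, the sequences $b_n$, $P(n)$ and $F_k(n)$ are uniquely determined by these conditions. *)

theory Defs
  imports Complex_Main
begin

text \<open>
  Sequences indexed by positive integers, and the family \<open>F\<^sub>k(n)\<close> (written \<open>F k n\<close>) with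
  \<open>1 \<le> k \<le> n\<close>, are total functions on \<open>nat\<close>; their values outside these index ranges are irrelevant.
\<close>

definition a' :: "(nat \<Rightarrow> complex) \<Rightarrow> nat \<Rightarrow> nat \<Rightarrow> complex" where
  "a' b i j = (if \<exists>r\<ge>1. j = r * i then of_nat i * b i else 0)"

definition solves ::
  "(nat \<Rightarrow> complex) \<Rightarrow> (nat \<Rightarrow> complex) \<Rightarrow> (nat \<Rightarrow> complex) \<Rightarrow> (nat \<Rightarrow> nat \<Rightarrow> complex) \<Rightarrow> bool" where
  "solves g P b F \<longleftrightarrow>
     P 0 = 1 \<and>
     (\<forall>n\<ge>1.
        (\<Sum>k=1..n. of_nat k * F k n) = of_nat n * P n \<and>
        (\<forall>i\<in>{1..n}. of_nat i * F i n = (\<Sum>j=1..n. a' b i j * P (n - j))) \<and>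
        of_nat n * P n = (\<Sum>k=1..n. g k * P (n - k)))"

end

theory Submission
  imports Defs
begin

text \<open>
  Summing the second condition over \<open>i\<close> turns the first one into a convolution of \<open>P\<close> with
  \<open>\<Sum>\<^bsub>d dvd j\<^esub> d b\<^sub>d\<close>. Since \<open>P(0) = 1\<close>, comparison with the third
  condition is equivalent to \<open>\<Sum>\<^bsub>d dvd n\<^esub> d b\<^sub>d = g(n)\<close> for all \<open>n\<close>, a triangular
  system with diagonal entries \<open>n \<noteq> 0\<close>. Likewise the third condition is a recursion that
  determines \<open>P\<close>, and the second one determines \<open>F\<close> from \<open>P\<close> and \<open>b\<close>.
\<close>

text \<open>For \<open>n \<ge> 1\<close> this is the sum of \<open>d * b d\<close> over the divisors
  \<open>d\<close> of \<open>n\<close>; writing it with \<open>a'\<close> lets it arise directly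
  from the second condition.\<close>

definition divisor_sum :: "(nat \<Rightarrow> complex) \<Rightarrow> nat \<Rightarrow> complex" where
  "divisor_sum b n = (\<Sum>i=1..n. a' b i n)"

lemma a'_self: "a' b n n = of_nat n * b n"
  by (auto simp: a'_def intro: exI[of _ "1::nat"])

lemma a'_eq_0: "1 \<le> j \<Longrightarrow> j < i \<Longrightarrow> a' b i j = 0"
  by (auto simp: a'_def)

lemma a'_cong: "b i = c i \<Longrightarrow> a' b i j = a' c i j"
  by (simp only: a'_def)

text \<open>No positive \<open>j\<close> is a multiple of a larger \<open>i\<close>, so the extra
  terms vanish. After exchanging sums, the inner range thus need not depend on
  \<open>j\<close>.\<close>

lemma divisor_sum_extend:
  assumes "1 \<le> j" "j \<le> n"
  shows "(\<Sum>i=1..n. a' b i j) = divisor_sum b j"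
  unfolding divisor_sum_def
  using assms by (intro sum.mono_neutral_right) (auto simp: a'_eq_0)

lemma divisor_sum_rec:
  assumes "1 \<le> n"
  shows "divisor_sum b n = of_nat n * b n + (\<Sum>i=1..<n. a' b i n)"
proof -
  have "{1..n} = insert n {1..<n}" using assms by auto
  then show ?thesis by (simp add: divisor_sum_def a'_self)
qed

lemma sum_a'_convolution:
  "(\<Sum>i=1..n. \<Sum>j=1..n. a' b i j * P (n - j)) = (\<Sum>j=1..n. divisor_sum b j * P (n - j))"
proof -
  have "(\<Sum>i=1..n. \<Sum>j=1..n. a' b i j * P (n - j)) = (\<Sum>j=1..n. (\<Sum>i=1..n. a' b i j) * P (n - j))"
    unfolding sum_distrib_right by (rule sum.swap)
  also have "\<dots> = (\<Sum>j=1..n. divisor_sum b j * P (n - j))"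
    by (intro sum.cong refl) (simp add: divisor_sum_extend del: One_nat_def)
  finally show ?thesis .
qed

text \<open>By strong induction all terms with \<open>k < n\<close> agree, which leaves
  \<open>x n * P 0 = y n * P 0\<close>.\<close>

lemma convolution_cancel:
  fixes x y P :: "nat \<Rightarrow> complex"
  assumes "P 0 = 1"
    and conv: "\<And>n. 1 \<le> n \<Longrightarrow> (\<Sum>k=1..n. x k * P (n - k)) = (\<Sum>k=1..n. y k * P (n - k))"
    and "1 \<le> n"
  shows "x n = y n"
  using \<open>1 \<le> n\<close>
proof (induction n rule: less_induct)
  case (less n)
  have last: "{1..n} = insert n {1..<n}" using less.prems by auto
  have "(\<Sum>k=1..<n. x k * P (n - k)) = (\<Sum>k=1..<n. y k * P (n - k))"
    by (intro sum.cong refl) (use less.IH in auto)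
  then show ?case
    using conv[OF less.prems] \<open>P 0 = 1\<close> by (simp add: last del: One_nat_def)
qed

lemma divisor_sum_inj:
  assumes "\<And>n. 1 \<le> n \<Longrightarrow> divisor_sum b n = divisor_sum c n" and "1 \<le> n"
  shows "b n = c n"
  using \<open>1 \<le> n\<close>
proof (induction n rule: less_induct)
  case (less n)
  have "(\<Sum>i=1..<n. a' b i n) = (\<Sum>i=1..<n. a' c i n)"
    by (intro sum.cong refl a'_cong) (use less.IH in auto)
  then show ?case
    using assms(1)[OF less.prems] less.prems by (simp add: divisor_sum_rec)
qed

fun conv_solution :: "(nat \<Rightarrow> complex) \<Rightarrow> nat \<Rightarrow> complex" where
  "conv_solution g n =
    (if n = 0 then 1 else (\<Sum>k=1..n. g k * conv_solution g (n - k)) / of_nat n)"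

text \<open>Forward substitution in the triangular system. \<open>a'\<close> is spelled out because
  it would take the function itself as an argument and hide that recursive calls occur only at
  \<open>i < n\<close>.\<close>

fun divisor_sum_inv :: "(nat \<Rightarrow> complex) \<Rightarrow> nat \<Rightarrow> complex" where
  "divisor_sum_inv g n =
    (g n - (\<Sum>i=1..<n. if \<exists>r\<ge>1. n = r * i then of_nat i * divisor_sum_inv g i else 0)) / of_nat n"

text \<open>Each equation matches the calls on its own right-hand side, so it is unfolded by hand,
  once.\<close>

declare conv_solution.simps [simp del] divisor_sum_inv.simps [simp del]

lemma divisor_sum_divisor_sum_inv:
  assumes "1 \<le> n"
  shows "divisor_sum (divisor_sum_inv g) n = g n"
proof -
  have "divisor_sum_inv g n = (g n - (\<Sum>i=1..<n. a' (divisor_sum_inv g) i n)) / of_nat n"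
    by (subst divisor_sum_inv.simps) (simp add: a'_def)
  then show ?thesis
    using assms by (simp add: divisor_sum_rec)
qed

lemma solves_divisor_sum:
  assumes "solves g P b F" "1 \<le> n"
  shows "divisor_sum b n = g n"
proof (rule convolution_cancel[OF _ _ \<open>1 \<le> n\<close>])
  show "P 0 = 1" using assms by (simp add: solves_def)
next
  fix m :: nat
  assume m: "1 \<le> m"
  have "(\<Sum>j=1..m. divisor_sum b j * P (m - j)) = (\<Sum>i=1..m. of_nat i * F i m)"
    unfolding sum_a'_convolution[symmetric]
    by (intro sum.cong refl) (use assms(1) m in \<open>auto simp: solves_def\<close>)
  also have "\<dots> = (\<Sum>k=1..m. g k * P (m - k))"
    using assms(1) m unfolding solves_def by metis
  finally show "(\<Sum>j=1..m. divisor_sum b j * P (m - j)) = (\<Sum>k=1..m. g k * P (m - k))" .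
qed

lemma solves_unique_P:
  assumes "solves g P b F" "solves g P' b' F'"
  shows "P n = P' n"
proof (induction n rule: less_induct)
  case (less n)
  show ?case
  proof (cases "n = 0")
    case True
    then show ?thesis using assms by (simp add: solves_def)
  next
    case False
    have "of_nat n * P n = (\<Sum>k=1..n. g k * P (n - k))"
      using assms(1) False by (simp add: solves_def)
    also have "\<dots> = (\<Sum>k=1..n. g k * P' (n - k))"
      by (intro sum.cong refl) (use less.IH in auto)
    also have "\<dots> = of_nat n * P' n"
      using assms(2) False by (simp add: solves_def)
    finally show ?thesis using False by simp
  qed
qed

lemma solves_unique_b:
  assumes "solves g P b F" "solves g P' b' F'" "1 \<le> n"
  shows "b n = b' n"
  using assms by (intro divisor_sum_inj[of b b']) (simp_all add: solves_divisor_sum)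

lemma solves_unique_F:
  assumes "solves g P b F" "solves g P' b' F'" "k \<in> {1..n}"
  shows "F k n = F' k n"
proof -
  have "of_nat k * F k n = (\<Sum>j=1..n. a' b k j * P (n - j))"
    using assms by (auto simp: solves_def)
  \<comment> \<open>Only the value of \<open>b\<close> at \<open>k \<ge> 1\<close> enters
    \<open>a' b k j\<close>, so agreement at positive indices is enough.\<close>
  also have "\<dots> = (\<Sum>j=1..n. a' b' k j * P' (n - j))"
    using a'_cong[of b k b'] solves_unique_b[OF assms(1,2), of k]
      solves_unique_P[OF assms(1,2)] assms(3) by simp
  also have "\<dots> = of_nat k * F' k n"
    using assms by (auto simp: solves_def)
  finally show ?thesis using assms(3) by simp
qed

lemma solves_exists: "\<exists>P b F. solves g P b F"
proof -
  define P where "P = conv_solution g"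
  define b where "b = divisor_sum_inv g"
  define F where "F = (\<lambda>i n. (\<Sum>j=1..n. a' b i j * P (n - j)) / of_nat i)"
  have P0: "P 0 = 1" by (simp add: P_def conv_solution.simps)
  have P: "of_nat n * P n = (\<Sum>k=1..n. g k * P (n - k))" if "1 \<le> n" for n
    unfolding P_def using that by (subst conv_solution.simps) simp
  have F: "of_nat i * F i n = (\<Sum>j=1..n. a' b i j * P (n - j))" if "i \<in> {1..n}" for i n
    using that by (simp add: F_def)
  \<comment> \<open>The other conditions hold by construction; this one is where the choice of
    \<open>b\<close> matters.\<close>
  have "(\<Sum>i=1..n. of_nat i * F i n) = of_nat n * P n" if "1 \<le> n" for n
  proof -
    have "(\<Sum>i=1..n. of_nat i * F i n) = (\<Sum>j=1..n. divisor_sum b j * P (n - j))"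
      unfolding sum_a'_convolution[symmetric] by (intro sum.cong refl F)
    also have "\<dots> = of_nat n * P n"
      unfolding P[OF that] b_def
      by (intro sum.cong refl) (simp add: divisor_sum_divisor_sum_inv)
    finally show ?thesis .
  qed
  then have "solves g P b F"
    using P0 P F by (simp add: solves_def)
  then show ?thesis by blast
qed

theorem theorem4p3:
  fixes g :: "nat \<Rightarrow> complex"
  shows "(\<exists>P b F. solves g P b F) \<and>
    (\<forall>P b F P' b' F'. solves g P b F \<longrightarrow> solves g P' b' F' \<longrightarrow>
      (\<forall>n. P n = P' n) \<and>
      (\<forall>n\<ge>1. b n = b' n) \<and>
      (\<forall>n\<ge>1. \<forall>k\<in>{1..n}. F k n = F' k n))"
  using solves_exists solves_unique_P solves_unique_b solves_unique_F by meson

end
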